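(* Assume that $p>1$ and $f:(0,+\infty)\to\mathbb{R}$ is a locally Lipschitz continuous function such that $f$ is strictly decreasing on $(0,\rho)$ for some $\rho>0$. Let $u \in C^{1,\alpha}_{\rm loc}(\mathbb{R}^N_+) \cap C(\overline{\mathbb{R}^N_+})$ be a (weak) solution to $$-\Delta_p u = f(u) \text{ in } \mathbb{R}^N_+,\qquad u>0 \text{ in } \mathbb{R}^N_+,\qquad u=0 \text{ on } \partial\mathbb{R}^N_+.$$ If $\|u\|_{L^\infty(\Sigma_{\overline\lambda})} < \rho$ for some $\overline\lambda>0$, then $$\lim_{x_N\to0^+} u(x',x_N) = 0 \quad\text{uniformly in } x'\in\mathbb{R}^{N-1}.$$
   Context: $N\ge 1$ is an integer, $\mathbb{R}^N_+=\{x=(x',x_N)\in\mathbb{R}^{N-1}\times\mathbb{R} : x_N>0\}$, and $\Sigma_\lambda=\{(x',x_N)\in\mathbb{R}^N : 0<x_N<\lambda\}$ for $\lambda>0$. $\Delta_p u=\mathrm{div}(|\nabla u|^{p-2}\nabla u)$ is the $p$-Laplacian. The exponent $\alpha$ is some number in $(0,1)$. Solutions are understood weakly: $\int_{\mathbb{R}^N_+} (|\nabla u|^{p-2} \nabla u, \nabla \varphi) = \int_{\mathbb{R}^N_+} f(u) \varphi$ for all $\varphi\in C^1_c(\mathbb{R}^N_+)$, where $(\cdot,\cdot)$ is the Euclidean inner product; the conditions $u>0$ in $\mathbb{R}^N_+$ and $u=0$ on $\partial\mathbb{R}^N_+$ hold pointwise. *)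

theory Defs
  imports "HOL-Analysis.Analysis" "HOL-Probability.Essential_Supremum"
begin

text \<open>
  Euclidean space of dimension \<open>N \<ge> 1\<close> is \<open>real ^ 'n\<close> with \<open>N = CARD('n)\<close>. An index type carries
  no order, so an arbitrary index \<open>k\<close> plays the role of the last coordinate; this also covers
  \<open>N = 1\<close>, where \<open>real ^ 'n\<close> has no nontrivial tangential directions.
\<close>

definition half_space :: "'n::finite \<Rightarrow> (real ^ 'n) set" where
  "half_space k = {x. 0 < x $ k}"

definition strip :: "'n::finite \<Rightarrow> real \<Rightarrow> (real ^ 'n) set" where
  "strip k l = {x. 0 < x $ k \<and> x $ k < l}"

lemma open_half_space: "open (half_space k)"
  unfolding half_space_def by (rule open_halfspace_component_gt_cart)

lemma closure_half_space: "closure (half_space k) = {x. 0 \<le> x $ k}"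
  unfolding half_space_def by simp

lemma frontier_half_space: "frontier (half_space k) = {x. x $ k = 0}"
  unfolding frontier_def interior_open[OF open_half_space] closure_half_space
  by (auto simp: half_space_def)

text \<open>The gradient is unspecified at points where the function is not differentiable.\<close>

definition grad :: "('a::euclidean_space \<Rightarrow> real) \<Rightarrow> 'a \<Rightarrow> 'a" where
  "grad u x = (THE D. GDERIV u x :> D)"

lemma grad_eqI:
  assumes "GDERIV u x :> D"
  shows "grad u x = D"
proof -
  have "E = D" if "GDERIV u x :> E" for E
  proof -
    have "(\<lambda>h. h \<bullet> E) = (\<lambda>h. h \<bullet> D)"
      using that assms unfolding gderiv_def by (rule has_derivative_unique)
    then show ?thesis by (metis vector_eq_ldot)
  qed
  with assms show ?thesis unfolding grad_def by blast
qed

lemma GDERIV_grad: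
  assumes "u differentiable (at x)"
  shows "GDERIV u x :> grad u x"
proof -
  from assms obtain L where L: "(u has_derivative L) (at x)"
    by (auto simp: differentiable_def)
  then have "L = (\<lambda>h. h \<bullet> adjoint L 1)"
    by (auto simp: adjoint_works has_derivative_linear)
  with L have "GDERIV u x :> adjoint L 1"
    by (simp add: gderiv_def)
  with grad_eqI show ?thesis by metis
qed

definition C1_on :: "('a::euclidean_space) set \<Rightarrow> ('a \<Rightarrow> real) \<Rightarrow> bool" where
  "C1_on S u \<longleftrightarrow> (\<forall>x\<in>S. u differentiable (at x)) \<and> continuous_on S (grad u)"

definition C1_holder_loc :: "real \<Rightarrow> ('a::euclidean_space) set \<Rightarrow> ('a \<Rightarrow> real) \<Rightarrow> bool" where
  "C1_holder_loc \<alpha> S u \<longleftrightarrow>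
     C1_on S u \<and>
     (\<forall>K. compact K \<and> K \<subseteq> S \<longrightarrow>
        (\<exists>C. \<forall>x\<in>K. \<forall>y\<in>K. norm (grad u x - grad u y) \<le> C * norm (x - y) powr \<alpha>))"

text \<open>
  Functions on \<open>S\<close> are total functions whose values outside \<open>S\<close> are ignored. In particular, the
  support of a test function is the closure of \<open>{x \<in> S. \<phi> x \<noteq> 0}\<close>, required to be a compact
  subset of \<open>S\<close>.
\<close>

definition C1_compact_support :: "('a::euclidean_space) set \<Rightarrow> ('a \<Rightarrow> real) \<Rightarrow> bool" where
  "C1_compact_support S \<phi> \<longleftrightarrow>
     C1_on S \<phi> \<and> compact (closure (support_on S \<phi>)) \<and> closure (support_on S \<phi>) \<subseteq> S"

text \<open>
  Since \<open>0 powr a = 0\<close> for every \<open>a\<close>, the flux below vanishes where the gradient does, which is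
  the usual convention (and the continuous extension) for all \<open>p > 1\<close>.
\<close>

definition p_flux :: "real \<Rightarrow> ('a::euclidean_space \<Rightarrow> real) \<Rightarrow> 'a \<Rightarrow> 'a" where
  "p_flux p u x = norm (grad u x) powr (p - 2) *\<^sub>R grad u x"

text \<open>Weak formulation of \<open>- \<Delta>\<^sub>p u = f(u)\<close> in \<open>S\<close>.\<close>

definition weak_p_laplace_solution ::
    "real \<Rightarrow> (real \<Rightarrow> real) \<Rightarrow> ('a::euclidean_space) set \<Rightarrow> ('a \<Rightarrow> real) \<Rightarrow> bool" where
  "weak_p_laplace_solution p f S u \<longleftrightarrow>
     (\<forall>\<phi>. C1_compact_support S \<phi> \<longrightarrow>
        (LINT x:S|lebesgue. p_flux p u x \<bullet> grad \<phi> x) = (LINT x:S|lebesgue. f (u x) * \<phi> x))"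

definition Linf_norm :: "('a::euclidean_space) set \<Rightarrow> ('a \<Rightarrow> real) \<Rightarrow> ereal" where
  "Linf_norm S u = esssup (lebesgue_on S) (\<lambda>x. ereal \<bar>u x\<bar>)"

text \<open>\<open>local_lipschitz\<close> has a time parameter, which is irrelevant here.\<close>

definition locally_lipschitz_on :: "real set \<Rightarrow> (real \<Rightarrow> real) \<Rightarrow> bool" where
  "locally_lipschitz_on S f \<longleftrightarrow> local_lipschitz (UNIV :: real set) S (\<lambda>_. f)"

end

theory Submission
  imports Defs "HOL-Real_Asymp.Real_Asymp"
begin

text \<open>
  The equation may be singular at the boundary, since \<open>f\<close> may blow up at 0, and the half space is
  unbounded in the tangential directions. Both difficulties disappear in a comparison that is local
  and takes place above a small level \<open>e > 0\<close>.

  Fix \<open>e\<close> in \<open>(0, \<rho>)\<close>. In the strip, \<open>u\<close> is bounded by some \<open>M < \<rho>\<close>, so wherever \<open>u > e\<close> there,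
  monotonicity of \<open>f\<close> gives \<open>- \<Delta>\<^sub>p u = f(u) < f(e)\<close>, a constant. For a boundary point \<open>z\<close> let \<open>c\<close> be the
  point at distance 1 below \<open>z\<close>, and put \<open>w(x) = e + B (1 - \<bar>x - c\<bar>\<^sup>-\<^sup>s)\<close>. For suitable \<open>s\<close> and large \<open>B\<close>
  this radial function satisfies \<open>- \<Delta>\<^sub>p w > f(e)\<close> at the points of the half space
  within distance \<open>1 + l / 2\<close> of \<open>c\<close>, and \<open>w > M\<close> at that distance, whereas \<open>w \<ge> e > 0 = u\<close> on the
  boundary of the half space. Weak comparison (\<open>weak_comparison\<close>) yields \<open>u \<le> w\<close> at these points, hence \<open>u \<le> e + B (1 - (1 + t)\<^sup>-\<^sup>s)\<close> at height \<open>t\<close>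
  above \<open>z\<close> (\<open>boundary_estimate\<close>). This is uniform in \<open>z\<close> and tends to the arbitrarily small \<open>e\<close>.

  The weak equation for \<open>w\<close> (\<open>weak_equation_radial_barrier\<close>) rests on an integration by parts for
  radial fields, which is deduced from translation invariance of the integral.
\<close>

section \<open>Functions with compact support\<close>

lemma GDERIV_0_off_support:
  fixes \<phi> :: "'a::euclidean_space \<Rightarrow> real"
  assumes "compact K" "\<And>x. x \<notin> K \<Longrightarrow> \<phi> x = 0" "x \<notin> K"
  shows "GDERIV \<phi> x :> 0"
proof -
  have "open (- K)" using assms(1) by (intro open_Compl compact_imp_closed)
  moreover have "0 = \<phi> y" if "y \<in> - K" for y using that assms(2) by simp
  ultimately have "(\<phi> has_derivative (\<lambda>_. 0)) (at x)"
    using assms(3) by (intro has_derivative_transform_within_open[OF has_derivative_const, of "- K" x]) simp_all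
  then show ?thesis by (simp add: gderiv_def)
qed

lemma C1_on_imp_continuous_on:
  fixes u :: "'a::euclidean_space \<Rightarrow> real"
  assumes "C1_on S u" shows "continuous_on S u"
  using assms unfolding C1_on_def
  by (auto intro!: continuous_at_imp_continuous_on differentiable_imp_continuous_within)

text \<open>
  A \<open>C\<^sup>1\<close> function on \<open>S\<close> that vanishes off a compact \<open>K \<subseteq> S\<close> is \<open>C\<^sup>1\<close> everywhere, because \<open>S\<close> and the
  complement of \<open>K\<close> are open and cover the space. So integration by parts on \<open>S\<close> reduces to
  the whole space, where translation invariance is available.
\<close>

lemma C1_on_UNIV_compact_support:
  fixes \<phi> :: "'a::euclidean_space \<Rightarrow> real"
  assumes "open S" "compact K" "K \<subseteq> S" "C1_on S \<phi>" and off: "\<And>x. x \<notin> K \<Longrightarrow> \<phi> x = 0"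
  shows "C1_on UNIV \<phi>"
proof -
  have zero: "GDERIV \<phi> x :> 0" if "x \<notin> K" for x
    using GDERIV_0_off_support assms(2) off that by blast
  have "open (- K)" using assms(2) by (intro open_Compl compact_imp_closed)
  moreover have "continuous_on (- K) (grad \<phi>)"
    using zero[THEN grad_eqI] by (intro continuous_on_eq[OF continuous_on_const[of _ 0]]) simp
  ultimately have "continuous_on (S \<union> - K) (grad \<phi>)"
    using assms by (intro continuous_on_open_Un) (auto simp: C1_on_def)
  moreover have "S \<union> - K = UNIV" using assms by auto
  moreover have "\<phi> differentiable (at x)" for x
    using zero[of x] assms(3,4) unfolding C1_on_def gderiv_def differentiable_def by blast
  ultimately show ?thesis by (simp add: C1_on_def)
qed

lemma C1_compact_supportI:
  fixes \<phi> :: "'a::euclidean_space \<Rightarrow> real"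
  assumes "compact K" "K \<subseteq> S" "C1_on S \<phi>" "\<And>x. x \<notin> K \<Longrightarrow> \<phi> x = 0"
  shows "C1_compact_support S \<phi>"
proof -
  have "support_on S \<phi> \<subseteq> K" using assms by (auto simp: support_on_def)
  then have "closure (support_on S \<phi>) \<subseteq> K"
    using assms(1) by (intro closure_minimal) (auto simp: compact_imp_closed)
  then show ?thesis
    using assms compact_Int_closed[OF assms(1), of "closure (support_on S \<phi>)"]
    by (auto simp: C1_compact_support_def Int_absorb1)
qed

lemma continuous_compact_support_set_integral:
  fixes h :: "'a::euclidean_space \<Rightarrow> real"
  assumes "compact K" "K \<subseteq> S" "continuous_on S h" "\<And>x. x \<notin> K \<Longrightarrow> h x = 0"
  shows "set_integrable lebesgue S h"
    and "(LINT x:S|lebesgue. h x) = integral\<^sup>L lborel h"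
proof -
  have eq: "(\<lambda>x. indicator S x *\<^sub>R h x) = h" "(\<lambda>x. indicator K x *\<^sub>R h x) = h"
    using assms by (auto simp: fun_eq_iff indicator_def)
  have "integrable lborel (\<lambda>x. indicator K x *\<^sub>R h x)"
    using assms by (intro borel_integrable_compact) (auto intro: continuous_on_subset)
  then have int: "integrable lborel h" unfolding eq .
  then have meas: "h \<in> borel_measurable lborel" by simp
  show "set_integrable lebesgue S h"
    unfolding set_integrable_def eq using int meas integrable_completion by blast
  show "(LINT x:S|lebesgue. h x) = integral\<^sup>L lborel h"
    unfolding set_lebesgue_integral_def eq using meas by (rule integral_completion)
qed

lemma DERIV_positive_part_squared:
  "((\<lambda>s::real. (max 0 s)\<^sup>2) has_real_derivative 2 * max 0 s) (at s)"
proof -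
  consider "s < 0" | "s = 0" | "s > 0" by linarith
  then show ?thesis
  proof cases
    case 1
    have "((\<lambda>s::real. 0) has_real_derivative 0) (at s)" by simp
    then have "((\<lambda>s::real. (max 0 s)\<^sup>2) has_real_derivative 0) (at s)"
      by (rule has_field_derivative_transform_within_open[where S = "{..<0}"]) (use 1 in auto)
    with 1 show ?thesis by simp
  next
    case 2
    have "((\<lambda>h::real. (max 0 h)\<^sup>2 / h) \<longlongrightarrow> 0) (at 0)"
    proof (rule Lim_null_comparison)
      show "\<forall>\<^sub>F h in at 0. norm ((max 0 h)\<^sup>2 / h) \<le> \<bar>h\<bar>" for h :: real
        by (auto simp: max_def power2_eq_square)
      show "((\<lambda>h::real. \<bar>h\<bar>) \<longlongrightarrow> 0) (at 0)"
        by (intro tendsto_rabs_zero tendsto_ident_at)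
    qed
    with 2 show ?thesis by (simp add: DERIV_def)
  next
    case 3
    have "((\<lambda>s::real. s\<^sup>2) has_real_derivative 2 * s) (at s)"
      by (auto intro!: derivative_eq_intros)
    then have "((\<lambda>s::real. (max 0 s)\<^sup>2) has_real_derivative 2 * s) (at s)"
      by (rule has_field_derivative_transform_within_open[where S = "{0<..}"]) (use 3 in auto)
    with 3 show ?thesis by simp
  qed
qed

lemma open_AE_notin_empty:
  fixes T :: "'a::euclidean_space set"
  assumes "open T" "AE x in lebesgue. x \<notin> T"
  shows "T = {}"
proof -
  have "T \<in> sets lebesgue" using assms(1) borel_open by auto
  then have "T \<in> null_sets lebesgue" using assms(2) by (simp add: AE_iff_null_sets)
  then have "negligible T" by (simp add: negligible_iff_null_sets)
  with assms(1) open_not_negligible show ?thesis by blast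
qed

text \<open>
  A continuous function that exceeds a number somewhere exceeds it on a nonempty open set, which is
  not null; so the essential supremum over an open set bounds every value there.
\<close>

lemma Linf_norm_less_imp_bound:
  assumes "open S" "continuous_on S u" "Linf_norm S u < ereal \<rho>"
  obtains M where "M < \<rho>" "\<And>x. x \<in> S \<Longrightarrow> u x \<le> M"
proof -
  obtain M where M: "Linf_norm S u < ereal M" "M < \<rho>"
    using ereal_dense2[OF assms(3)] by auto
  have S: "S \<inter> space lebesgue \<in> sets lebesgue" using assms(1) borel_open by auto
  have "AE x in lebesgue_on S. ereal \<bar>u x\<bar> \<le> Linf_norm S u"
    unfolding Linf_norm_def by (rule esssup_AE)
  then have "AE x in lebesgue. x \<in> S \<longrightarrow> ereal \<bar>u x\<bar> \<le> Linf_norm S u"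
    using S by (simp add: AE_restrict_space_iff)
  then have "AE x in lebesgue. x \<notin> {x\<in>S. M < u x}"
  proof (elim AE_mp, intro AE_I2 impI)
    fix x assume "x \<in> S \<longrightarrow> ereal \<bar>u x\<bar> \<le> Linf_norm S u"
    then have "x \<in> S \<Longrightarrow> ereal \<bar>u x\<bar> < ereal M" using M(1) le_less_trans by blast
    then show "x \<notin> {x\<in>S. M < u x}" by auto
  qed
  moreover have "open {x\<in>S. M < u x}"
    using open_Collect_less_Int[OF continuous_on_const assms(2), of M] assms(1) open_Int by metis
  ultimately have "{x\<in>S. M < u x} = {}" using open_AE_notin_empty by blast
  then have "x \<in> S \<Longrightarrow> u x \<le> M" for x by (auto simp: not_less)
  with M(2) that show ?thesis by blast
qed

section \<open>Monotonicity of the flux and weak comparison\<close>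

text \<open>
  By Cauchy--Schwarz the left-hand side is at least \<open>(A\<^sup>p\<^sup>-\<^sup>1 - B\<^sup>p\<^sup>-\<^sup>1) (A - B)\<close> with \<open>A = \<bar>a\<bar>\<close> and
  \<open>B = \<bar>b\<bar>\<close>, and \<open>t \<mapsto> t\<^sup>p\<^sup>-\<^sup>1\<close> is increasing.
\<close>

lemma p_flux_map_monotone:
  fixes a b :: "'a::real_inner"
  assumes "p > 1"
  shows "(norm a powr (p - 2) *\<^sub>R a - norm b powr (p - 2) *\<^sub>R b) \<bullet> (a - b) \<ge> 0"
proof -
  define A B where "A = norm a" and "B = norm b"
  have nonneg: "A \<ge> 0" "B \<ge> 0" by (simp_all add: A_def B_def)
  have pw: "t powr (p - 2) * t = t powr (p - 1)" if "t \<ge> 0" for t :: real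
    using that powr_add[of t "p - 2" 1] by (cases "t = 0") auto
  have "(A powr (p - 1) - B powr (p - 1)) * (A - B) \<ge> 0"
  proof (cases "A \<le> B")
    case True
    then have "A powr (p - 1) \<le> B powr (p - 1)"
      using nonneg assms by (intro powr_mono2) auto
    with True show ?thesis by (simp add: mult_nonpos_nonpos)
  next
    case False
    then have "B powr (p - 1) \<le> A powr (p - 1)"
      using nonneg assms by (intro powr_mono2) auto
    with False show ?thesis by simp
  qed
  also have "(A powr (p - 1) - B powr (p - 1)) * (A - B) =
      A powr (p - 2) * A\<^sup>2 + B powr (p - 2) * B\<^sup>2 - (A powr (p - 2) + B powr (p - 2)) * (A * B)"
    using pw[OF nonneg(1), symmetric] pw[OF nonneg(2), symmetric]
    by (simp add: algebra_simps power2_eq_square)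
  also have "\<dots> \<le> A powr (p - 2) * A\<^sup>2 + B powr (p - 2) * B\<^sup>2 - (A powr (p - 2) + B powr (p - 2)) * (a \<bullet> b)"
    using norm_cauchy_schwarz[of a b] unfolding A_def B_def
    by (intro diff_left_mono mult_left_mono add_nonneg_nonneg powr_ge_zero) auto
  also have "\<dots> = (norm a powr (p - 2) *\<^sub>R a - norm b powr (p - 2) *\<^sub>R b) \<bullet> (a - b)"
    unfolding A_def B_def power2_norm_eq_inner
    by (simp add: algebra_simps inner_commute)
  finally show ?thesis .
qed

text \<open>
  For \<open>p < 2\<close> the factor \<open>\<bar>v\<bar>\<^sup>p\<^sup>-\<^sup>2\<close> is unbounded near the origin; there continuity comes from the norm
  of the flux being \<open>\<bar>v\<bar>\<^sup>p\<^sup>-\<^sup>1\<close>.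
\<close>

lemma isCont_p_flux_map:
  fixes v :: "'a::real_normed_vector"
  assumes "p > 1"
  shows "isCont (\<lambda>v. norm v powr (p - 2) *\<^sub>R v) v"
proof (cases "v = 0")
  case False
  then show ?thesis by (intro continuous_intros) auto
next
  case True
  have "((\<lambda>v::'a. norm v powr (p - 1)) \<longlongrightarrow> 0 powr (p - 1)) (at 0)"
    using assms by (intro tendsto_powr' tendsto_const tendsto_norm_zero tendsto_ident_at)
      (auto simp: eventually_at_topological)
  moreover have "norm (norm v powr (p - 2) *\<^sub>R v) = norm v powr (p - 1)" for v :: 'a
    using powr_add[of "norm v" "p - 2" 1] by (cases "v = 0") auto
  ultimately have "((\<lambda>v::'a. norm (norm v powr (p - 2) *\<^sub>R v)) \<longlongrightarrow> 0) (at 0)"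
    using assms by simp
  then show ?thesis
    unfolding True isCont_def by (simp add: tendsto_norm_zero_iff del: norm_scaleR)
qed

lemma continuous_on_p_flux:
  fixes u :: "'a::euclidean_space \<Rightarrow> real"
  assumes "p > 1" "C1_on S u"
  shows "continuous_on S (p_flux p u)"
proof -
  have "continuous_on UNIV (\<lambda>v::'a. norm v powr (p - 2) *\<^sub>R v)"
    by (intro continuous_at_imp_continuous_on ballI isCont_p_flux_map assms)
  from continuous_on_compose2[OF this, of S "grad u"] assms(2) show ?thesis
    unfolding p_flux_def C1_on_def by auto
qed

text \<open>
  Testing both equations with \<open>((u - w)\<^sup>+)\<^sup>2\<close>, cut off outside \<open>D\<close>, and subtracting them gives a
  left-hand side that is nonnegative by monotonicity of the flux, and a right-hand side whose
  integrand is negative wherever \<open>u > w\<close> in \<open>D\<close>. The square makes the test function \<open>C\<^sup>1\<close>, as the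
  weak formulation demands. The compactness hypothesis replaces boundary conditions on \<open>D\<close>: it says
  that \<open>u < w\<close> near the boundary of \<open>D\<close> and, for unbounded \<open>D\<close>, far out.
\<close>

lemma weak_comparison:
  fixes u w q :: "'a::euclidean_space \<Rightarrow> real"
  assumes "p > 1" "open S" "C1_on S u" "C1_on S w"
    and contf: "continuous_on S (\<lambda>x. f (u x))" and contq: "continuous_on S q"
    and u: "weak_p_laplace_solution p f S u"
    and w: "\<And>\<phi> K. compact K \<Longrightarrow> K \<subseteq> S \<Longrightarrow> C1_on S \<phi> \<Longrightarrow> (\<And>x. x \<notin> K \<Longrightarrow> \<phi> x = 0) \<Longrightarrow>
      (LINT x:S|lebesgue. p_flux p w x \<bullet> grad \<phi> x) = (LINT x:S|lebesgue. q x * \<phi> x)"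
    and "open D" "D \<subseteq> S" and K: "compact {x\<in>D. w x \<le> u x}"
    and less: "\<And>x. x \<in> D \<Longrightarrow> w x < u x \<Longrightarrow> f (u x) < q x"
    and "x \<in> D"
  shows "u x \<le> w x"
proof -
  define K where "K = {x\<in>D. w x \<le> u x}"
  have K: "compact K" "K \<subseteq> D" "K \<subseteq> S" using assms by (auto simp: K_def)
  define \<phi> where "\<phi> x = (if x \<in> D then (max 0 (u x - w x))\<^sup>2 else 0)" for x
  have off: "\<phi> x = 0" if "x \<notin> K" for x
    using that by (auto simp: \<phi>_def K_def)
  have D\<phi>: "GDERIV \<phi> x :> (2 * max 0 (u x - w x)) *\<^sub>R (grad u x - grad w x)" if "x \<in> D" for x
  proof -
    have "GDERIV (\<lambda>x. u x - w x) x :> grad u x - grad w x"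
      using that assms by (intro GDERIV_diff GDERIV_grad) (auto simp: C1_on_def)
    from GDERIV_DERIV_compose[OF this DERIV_positive_part_squared]
    show ?thesis unfolding gderiv_def
      by (rule has_derivative_transform_within_open[OF _ \<open>open D\<close> that]) (simp add: \<phi>_def)
  qed
  have grad_in: "grad \<phi> x = (2 * max 0 (u x - w x)) *\<^sub>R (grad u x - grad w x)" if "x \<in> D" for x
    using D\<phi>[OF that] by (rule grad_eqI)
  have grad_off: "grad \<phi> x = 0" if "x \<notin> K" for x
    using GDERIV_0_off_support[OF K(1) off that] by (rule grad_eqI)
  have cont: "continuous_on S u" "continuous_on S w"
    "continuous_on S (grad u)" "continuous_on S (grad w)"
    using assms by (auto simp: C1_on_def intro: C1_on_imp_continuous_on)
  have "continuous_on D (grad \<phi>)"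
  proof -
    have "continuous_on D (\<lambda>x. (2 * max 0 (u x - w x)) *\<^sub>R (grad u x - grad w x))"
      using \<open>D \<subseteq> S\<close> by (intro continuous_intros cont[THEN continuous_on_subset])
    then show ?thesis by (rule continuous_on_eq) (simp add: grad_in)
  qed
  then have "C1_on D \<phi>"
    using D\<phi> unfolding C1_on_def gderiv_def differentiable_def by blast
  then have "C1_on UNIV \<phi>"
    using C1_on_UNIV_compact_support[OF \<open>open D\<close> K(1,2)] off by blast
  then have C1: "C1_on S \<phi>" unfolding C1_on_def by (auto intro: continuous_on_subset)
  have cont\<phi>: "continuous_on S \<phi>" "continuous_on S (grad \<phi>)"
    using C1 by (auto simp: C1_on_def intro: C1_on_imp_continuous_on)
  have cont_flux: "continuous_on S (p_flux p u)" "continuous_on S (p_flux p w)"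
    using assms by (auto intro: continuous_on_p_flux)
  note int = continuous_compact_support_set_integral(1)[OF K(1,3)]
  have int_flux: "set_integrable lebesgue S (\<lambda>x. p_flux p u x \<bullet> grad \<phi> x)"
    "set_integrable lebesgue S (\<lambda>x. p_flux p w x \<bullet> grad \<phi> x)"
    using grad_off by (auto intro!: int continuous_intros cont_flux cont\<phi>)
  have int_rhs: "set_integrable lebesgue S (\<lambda>x. q x * \<phi> x)"
    "set_integrable lebesgue S (\<lambda>x. f (u x) * \<phi> x)"
    using off by (auto intro!: int continuous_intros contf contq cont\<phi>)
  have "0 \<le> (LINT x:S|lebesgue. (p_flux p u x - p_flux p w x) \<bullet> grad \<phi> x)"
  proof -
    have "0 \<le> (p_flux p u x - p_flux p w x) \<bullet> grad \<phi> x" for x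
    proof (cases "x \<in> K")
      case True
      then have "grad \<phi> x = (2 * max 0 (u x - w x)) *\<^sub>R (grad u x - grad w x)"
        using K grad_in by auto
      then show ?thesis
        using p_flux_map_monotone[OF \<open>p > 1\<close>, of "grad u x" "grad w x"]
        by (simp add: p_flux_def)
    qed (simp add: grad_off)
    then show ?thesis unfolding set_lebesgue_integral_def by (intro integral_nonneg_AE) simp
  qed
  also have "\<dots> = (LINT x:S|lebesgue. p_flux p u x \<bullet> grad \<phi> x) - (LINT x:S|lebesgue. p_flux p w x \<bullet> grad \<phi> x)"
    using int_flux by (simp add: inner_diff_left set_integral_diff)
  also have "(LINT x:S|lebesgue. p_flux p u x \<bullet> grad \<phi> x) = (LINT x:S|lebesgue. f (u x) * \<phi> x)"
    using u C1_compact_supportI[OF K(1,3) C1 off] by (simp add: weak_p_laplace_solution_def)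
  also have "(LINT x:S|lebesgue. p_flux p w x \<bullet> grad \<phi> x) = (LINT x:S|lebesgue. q x * \<phi> x)"
    using w K C1 off by blast
  also have "(LINT x:S|lebesgue. f (u x) * \<phi> x) - (LINT x:S|lebesgue. q x * \<phi> x) =
      - (LINT x:S|lebesgue. (q x - f (u x)) * \<phi> x)"
    using int_rhs by (simp add: left_diff_distrib set_integral_diff)
  finally have le: "integral\<^sup>L lebesgue (\<lambda>x. indicator S x *\<^sub>R ((q x - f (u x)) * \<phi> x)) \<le> 0"
    by (simp add: set_lebesgue_integral_def)
  have pos: "0 < (q x - f (u x)) * \<phi> x" if "x \<in> D" "w x < u x" for x
    using that less by (simp add: \<phi>_def)
  have nonneg: "0 \<le> indicator S x *\<^sub>R ((q x - f (u x)) * \<phi> x)" for x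
  proof (cases "x \<in> D \<and> w x < u x")
    case True
    then show ?thesis using pos[of x] by (simp add: indicator_def)
  next
    case False
    then have "\<phi> x = 0" by (auto simp: \<phi>_def)
    then show ?thesis by simp
  qed
  have "integrable lebesgue (\<lambda>x. indicator S x *\<^sub>R ((q x - f (u x)) * \<phi> x))"
    using set_integral_diff(1)[OF int_rhs] unfolding set_integrable_def by (simp add: left_diff_distrib)
  then have "AE x in lebesgue. indicator S x *\<^sub>R ((q x - f (u x)) * \<phi> x) = 0"
    using le nonneg by (subst integral_nonneg_eq_0_iff_AE[symmetric])
      (auto intro!: antisym integral_nonneg_AE simp del: real_scaleR_def)
  then have "AE x in lebesgue. x \<notin> {x\<in>D. w x < u x}"
    using pos \<open>D \<subseteq> S\<close> by (elim AE_mp, intro AE_I2) (fastforce simp: indicator_def)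
  moreover have "open {x\<in>D. w x < u x}"
  proof -
    have "continuous_on D u" "continuous_on D w"
      using cont \<open>D \<subseteq> S\<close> by (auto intro: continuous_on_subset)
    from open_Collect_less_Int[OF this(2,1)] show ?thesis
      using \<open>open D\<close> open_Int by metis
  qed
  ultimately have "{x\<in>D. w x < u x} = {}" using open_AE_notin_empty by blast
  then show ?thesis using \<open>x \<in> D\<close> by auto
qed

section \<open>Integration by parts for radial fields\<close>

text \<open>
  By translation invariance the difference quotients of \<open>G\<close> in direction \<open>b\<close> have integral zero, and
  they converge to the derivative. They are dominated because, by the mean value theorem, they are
  bounded by the maximum of the derivative and vanish off one fixed compact set.
\<close>

lemma integral_directional_derivative_eq_0:
  fixes G :: "'a::euclidean_space \<Rightarrow> real"
  assumes K: "compact K" and off: "\<And>x. x \<notin> K \<Longrightarrow> G x = 0"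
    and der: "\<And>x. (G has_derivative G' x) (at x)"
    and cont: "continuous_on UNIV (\<lambda>x. G' x b)"
  shows "integral\<^sup>L lborel (\<lambda>x. G' x b) = 0"
proof -
  have contG: "continuous_on UNIV G"
    using has_derivative_continuous[OF der] by (simp add: continuous_on_eq_continuous_at)
  then have [measurable]: "G \<in> borel_measurable borel"
    by (rule borel_measurable_continuous_onI)
  have "integrable lborel (\<lambda>x. indicator K x *\<^sub>R G x)"
    using K contG by (intro borel_integrable_compact) (auto intro: continuous_on_subset)
  also have "(\<lambda>x. indicator K x *\<^sub>R G x) = G"
    using off by (auto simp: fun_eq_iff indicator_def)
  finally have intG: "integrable lborel G" .
  have path: "((\<lambda>t. G (x + t *\<^sub>R b)) has_real_derivative G' (x + t *\<^sub>R b) b) (at t)" for x t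
  proof -
    have "((\<lambda>t. G (x + t *\<^sub>R b)) has_derivative (\<lambda>h. G' (x + t *\<^sub>R b) (h *\<^sub>R b))) (at t)"
      by (rule has_derivative_compose[where f = "\<lambda>t. x + t *\<^sub>R b", OF _ der])
        (auto intro!: derivative_eq_intros)
    moreover have "G' (x + t *\<^sub>R b) (h *\<^sub>R b) = G' (x + t *\<^sub>R b) b * h" for h
      using linear_scale[OF has_derivative_linear[OF der]] by simp
    ultimately show ?thesis unfolding has_field_derivative_def by simp
  qed
  have derivative_off: "G' x b = 0" if "x \<notin> K" for x
  proof -
    have "(G has_derivative (\<lambda>_. 0)) (at x)"
      using GDERIV_0_off_support[OF K off that] by (simp add: gderiv_def)
    with der have "G' x = (\<lambda>_. 0)" by (rule has_derivative_unique)
    then show ?thesis by simp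
  qed
  obtain C where C: "\<And>x. x \<in> K \<Longrightarrow> norm (G' x b) \<le> C" "C > 0"
  proof -
    have "bounded ((\<lambda>x. G' x b) ` K)"
      using K cont by (intro compact_imp_bounded compact_continuous_image)
        (auto intro: continuous_on_subset)
    with that show ?thesis by (auto simp: bounded_pos)
  qed
  have bound: "\<bar>G' x b\<bar> \<le> C" for x
    using C derivative_off by (cases "x \<in> K") force+
  \<comment> \<open>The points that a shift by at most \<open>b\<close> can carry into \<open>K\<close>: off this set all difference
    quotients with step at most 1 vanish.\<close>
  define K' where "K' = (\<lambda>(x, t). x - t *\<^sub>R b) ` (K \<times> {0..1})"
  have K': "compact K'"
    unfolding K'_def using K
    by (intro compact_continuous_image compact_Times) (auto intro!: continuous_intros simp: case_prod_unfold)
  then have [measurable]: "K' \<in> sets borel" by (simp add: borel_compact)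
  define s where "s n = 1 / real (Suc n)" for n
  have s: "0 < s n" "s n \<le> 1" for n by (auto simp: s_def field_simps)
  define D where "D n x = (G (s n *\<^sub>R b + x) - G x) / s n" for n x
  have integral_D: "integral\<^sup>L lborel (D n) = 0" for n
  proof -
    have "integral\<^sup>L lborel G = integral\<^sup>L (distr lborel borel ((+) (s n *\<^sub>R b))) G"
      by (simp add: lborel_distr_plus)
    then have "integral\<^sup>L lborel (\<lambda>x. G (s n *\<^sub>R b + x)) = integral\<^sup>L lborel G"
      by (simp add: integral_distr)
    moreover have "integrable lborel (\<lambda>x. G (s n *\<^sub>R b + x))"
    proof -
      have "integrable (distr lborel borel ((+) (s n *\<^sub>R b))) G"
        using intG by (simp add: lborel_distr_plus)
      then show ?thesis by (simp add: integrable_distr_eq)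
    qed
    ultimately show ?thesis using intG by (simp add: D_def[abs_def])
  qed
  have "(\<lambda>n. integral\<^sup>L lborel (D n)) \<longlonglongrightarrow> integral\<^sup>L lborel (\<lambda>x. G' x b)"
  proof (rule integral_dominated_convergence[where w = "\<lambda>x. indicator K' x *\<^sub>R C"])
    show "(\<lambda>x. G' x b) \<in> borel_measurable lborel"
      using borel_measurable_continuous_onI[OF cont] by simp
    show "D n \<in> borel_measurable lborel" for n unfolding D_def by measurable
    show "integrable lborel (\<lambda>x. indicator K' x *\<^sub>R C)"
      using K' by (intro borel_integrable_compact) auto
    show "AE x in lborel. (\<lambda>n. D n x) \<longlonglongrightarrow> G' x b"
    proof (intro AE_I2)
      fix x
      have "((\<lambda>h. (G (x + (0 + h) *\<^sub>R b) - G (x + 0 *\<^sub>R b)) / h) \<longlongrightarrow> G' (x + 0 *\<^sub>R b) b) (at 0)"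
        using path[of x 0] unfolding DERIV_def .
      then have "((\<lambda>h. (G (h *\<^sub>R b + x) - G x) / h) \<longlongrightarrow> G' x b) (at 0)"
        by (simp add: add.commute)
      moreover have "filterlim s (at 0) sequentially"
        using s LIMSEQ_Suc[OF lim_1_over_n] unfolding filterlim_at s_def[abs_def] by auto
      ultimately show "(\<lambda>n. D n x) \<longlonglongrightarrow> G' x b"
        unfolding D_def by (rule filterlim_compose)
    qed
    show "AE x in lborel. norm (D n x) \<le> indicator K' x *\<^sub>R C" for n
    proof (intro AE_I2)
      fix x
      show "norm (D n x) \<le> indicator K' x *\<^sub>R C"
      proof (cases "x \<in> K'")
        case True
        obtain z where "G (x + s n *\<^sub>R b) - G (x + 0 *\<^sub>R b) = (s n - 0) * G' (x + z *\<^sub>R b) b"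
          using MVT2[OF s(1) path, of n x] by blast
        then have "D n x = G' (x + z *\<^sub>R b) b"
          using s(1)[of n] by (simp add: D_def add.commute)
        then show ?thesis using True bound by simp
      next
        case False
        have "x + t *\<^sub>R b \<notin> K" if "t \<in> {0..1}" for t
        proof
          assume "x + t *\<^sub>R b \<in> K"
          then have "(x + t *\<^sub>R b) - t *\<^sub>R b \<in> K'" unfolding K'_def using that by force
          with False show False by simp
        qed
        from this[of 0] this[of "s n"] s[of n] have "x \<notin> K" "s n *\<^sub>R b + x \<notin> K"
          by (auto simp: add.commute)
        then show ?thesis using False off by (simp add: D_def)
      qed
    qed
  qed
  then show ?thesis by (simp add: integral_D LIMSEQ_const_iff)
qed

text \<open>
  The integrand is the divergence of \<open>\<psi> x *\<^sub>R (x - c)\<close>, that is, the sum over an orthonormal basis of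
  the directional derivatives of its components.
\<close>

lemma integral_dilation_derivative_eq_0:
  fixes \<psi> :: "'a::euclidean_space \<Rightarrow> real"
  assumes K: "compact K" and off: "\<And>x. x \<notin> K \<Longrightarrow> \<psi> x = 0"
    and der: "\<And>x. GDERIV \<psi> x :> g x" and cont: "continuous_on UNIV g"
  shows "integral\<^sup>L lborel (\<lambda>x. DIM('a) * \<psi> x + (x - c) \<bullet> g x) = 0"
proof -
  define G' where "G' b x h = ((x - c) \<bullet> b) * (h \<bullet> g x) + (h \<bullet> b) * \<psi> x" for b x h :: 'a
  have cont\<psi>: "continuous_on UNIV \<psi>"
    using has_derivative_continuous[OF der[unfolded gderiv_def]]
    by (simp add: continuous_on_eq_continuous_at)
  have g_off: "g x = 0" if "x \<notin> K" for x
    using grad_eqI[OF GDERIV_0_off_support[OF K off that]] grad_eqI[OF der[of x]] by simp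
  have contG': "continuous_on UNIV (\<lambda>x. G' b x b)" for b
    unfolding G'_def by (intro continuous_intros cont cont\<psi>)
  have zero: "integral\<^sup>L lborel (\<lambda>x. G' b x b) = 0" for b
  proof (rule integral_directional_derivative_eq_0[OF K, where G = "\<lambda>x. ((x - c) \<bullet> b) * \<psi> x" and G' = "G' b"])
    show "((\<lambda>x. ((x - c) \<bullet> b) * \<psi> x) has_derivative G' b x) (at x)" for x
      using der[of x] unfolding gderiv_def G'_def
      by (auto intro!: derivative_eq_intros simp: fun_eq_iff inner_commute)
  qed (use off contG' in simp_all)
  have int: "integrable lborel (\<lambda>x. G' b x b)" for b
  proof -
    have "integrable lborel (\<lambda>x. indicator K x *\<^sub>R G' b x b)"
      using K contG' by (intro borel_integrable_compact) (auto intro: continuous_on_subset)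
    also have "(\<lambda>x. indicator K x *\<^sub>R G' b x b) = (\<lambda>x. G' b x b)"
      using off g_off by (auto simp: fun_eq_iff indicator_def G'_def)
    finally show ?thesis .
  qed
  have "DIM('a) * \<psi> x + (x - c) \<bullet> g x = (\<Sum>b\<in>Basis. G' b x b)" for x
  proof -
    have "(\<Sum>b\<in>Basis. G' b x b) = (\<Sum>b\<in>Basis. ((x - c) \<bullet> b) * (g x \<bullet> b) + \<psi> x)"
      unfolding G'_def by (intro sum.cong refl) (simp add: inner_same_Basis inner_commute[of _ "g x"])
    also have "\<dots> = (x - c) \<bullet> g x + DIM('a) * \<psi> x"
      by (simp only: sum.distrib euclidean_inner[symmetric] sum_constant)
    finally show ?thesis by simp
  qed
  then have "integral\<^sup>L lborel (\<lambda>x. DIM('a) * \<psi> x + (x - c) \<bullet> g x) =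
      integral\<^sup>L lborel (\<lambda>x. \<Sum>b\<in>Basis. G' b x b)"
    by (simp only:)
  also have "\<dots> = (\<Sum>b\<in>Basis. integral\<^sup>L lborel (\<lambda>x. G' b x b))"
    by (rule Bochner_Integration.integral_sum) (rule int)
  finally show ?thesis by (simp only: zero sum.neutral_const)
qed

lemma GDERIV_norm_powr:
  fixes c :: "'a::euclidean_space"
  assumes "x \<noteq> c"
  shows "GDERIV (\<lambda>x. norm (x - c) powr a) x :> (a * norm (x - c) powr (a - 2)) *\<^sub>R (x - c)"
proof -
  have "GDERIV norm (x - c) :> sgn (x - c)"
    using assms by (intro GDERIV_norm) auto
  then have "((\<lambda>x. norm (x - c)) has_derivative (\<lambda>h. h \<bullet> sgn (x - c))) (at x)"
    unfolding gderiv_def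
    by (rule has_derivative_compose[where f = "\<lambda>x. x - c", rotated]) (auto intro!: derivative_eq_intros)
  then have "GDERIV (\<lambda>x. norm (x - c)) x :> sgn (x - c)" by (simp add: gderiv_def)
  moreover have "DERIV (\<lambda>r. r powr a) (norm (x - c)) :> a * norm (x - c) powr (a - 1)"
    using assms by (intro has_real_derivative_powr) auto
  ultimately have "GDERIV (\<lambda>x. norm (x - c) powr a) x :> (a * norm (x - c) powr (a - 1)) *\<^sub>R sgn (x - c)"
    by (rule GDERIV_DERIV_compose)
  moreover have "norm (x - c) powr (a - 1) = norm (x - c) powr (a - 2) * norm (x - c)"
    using assms powr_add[of "norm (x - c)" "a - 2" 1] by simp
  moreover have "sgn (x - c) = inverse (norm (x - c)) *\<^sub>R (x - c)"
    by (simp add: sgn_div_norm)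
  moreover have "norm (x - c) * inverse (norm (x - c)) = 1"
    using assms by simp
  ultimately show ?thesis by (simp add: mult.assoc)
qed

text \<open>
  The field \<open>\<bar>x - c\<bar>\<^sup>-\<^sup>m (x - c)\<close> has divergence \<open>(N - m) \<bar>x - c\<bar>\<^sup>-\<^sup>m\<close> away from \<open>c\<close>, where \<open>N\<close> is the
  dimension; this is the corresponding weak identity. It follows from the previous lemma applied to
  \<open>\<psi> = \<bar>x - c\<bar>\<^sup>-\<^sup>m \<phi>\<close>, since the radial derivative of \<open>\<bar>x - c\<bar>\<^sup>-\<^sup>m\<close> contributes the factor \<open>- m\<close>.
\<close>

lemma weak_divergence_radial_field:
  fixes c :: "'a::euclidean_space"
  assumes "open S" "c \<notin> S" "compact K" "K \<subseteq> S" "C1_on S \<phi>" and off: "\<And>x. x \<notin> K \<Longrightarrow> \<phi> x = 0"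
  shows "(LINT x:S|lebesgue. (norm (x - c) powr (- m) *\<^sub>R (x - c)) \<bullet> grad \<phi> x) =
    (LINT x:S|lebesgue. (m - DIM('a)) * norm (x - c) powr (- m) * \<phi> x)"
proof -
  define h where "h x = norm (x - c) powr (- m)" for x
  define h' where "h' x = (- m * norm (x - c) powr (- m - 2)) *\<^sub>R (x - c)" for x
  define g where "g x = h x *\<^sub>R grad \<phi> x + \<phi> x *\<^sub>R h' x" for x
  have C1: "C1_on UNIV \<phi>" using C1_on_UNIV_compact_support assms by blast
  then have D\<phi>: "GDERIV \<phi> x :> grad \<phi> x" for x
    by (auto simp: C1_on_def intro: GDERIV_grad)
  have grad_off: "grad \<phi> x = 0" if "x \<notin> K" for x
    using GDERIV_0_off_support assms(3) off that grad_eqI by blast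
  have ne: "x \<noteq> c" if "x \<in> S" for x using that assms by auto
  have cont\<phi>: "continuous_on S \<phi>" "continuous_on S (grad \<phi>)"
    using C1_on_imp_continuous_on assms by (auto simp: C1_on_def)
  have conth: "continuous_on S h" "continuous_on S h'"
    unfolding h_def h'_def using ne by (auto intro!: continuous_intros)
  have D: "GDERIV (\<lambda>x. h x * \<phi> x) x :> g x" for x
  proof (cases "x \<in> K")
    case True
    then have "GDERIV h x :> h' x"
      unfolding h_def h'_def using ne assms by (intro GDERIV_norm_powr) auto
    from GDERIV_mult[OF this D\<phi>] show ?thesis by (simp add: g_def)
  next
    case False
    then show ?thesis
      using GDERIV_0_off_support[OF assms(3), of "\<lambda>x. h x * \<phi> x" x] off grad_off by (simp add: g_def)
  qed
  have contg: "continuous_on UNIV g"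
  proof -
    have "open (- K)" using assms(3) by (intro open_Compl compact_imp_closed)
    moreover have "continuous_on (- K) g"
      using off grad_off by (intro continuous_on_eq[OF continuous_on_const[of _ 0]]) (simp add: g_def)
    moreover have "continuous_on S g"
      unfolding g_def by (intro continuous_intros cont\<phi> conth)
    ultimately have "continuous_on (S \<union> - K) g"
      using assms by (intro continuous_on_open_Un) auto
    moreover have "S \<union> - K = UNIV" using assms by auto
    ultimately show ?thesis by simp
  qed
  have "0 = integral\<^sup>L lborel (\<lambda>x. DIM('a) * (h x * \<phi> x) + (x - c) \<bullet> g x)"
    using off by (intro integral_dilation_derivative_eq_0[OF assms(3) _ D contg, symmetric]) auto
  also have "(\<lambda>x. DIM('a) * (h x * \<phi> x) + (x - c) \<bullet> g x) =
      (\<lambda>x. (h x *\<^sub>R (x - c)) \<bullet> grad \<phi> x - (m - DIM('a)) * h x * \<phi> x)"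
  proof
    fix x
    show "DIM('a) * (h x * \<phi> x) + (x - c) \<bullet> g x =
        (h x *\<^sub>R (x - c)) \<bullet> grad \<phi> x - (m - DIM('a)) * h x * \<phi> x"
    proof (cases "x = c")
      case True
      then have "\<phi> x = 0" using off assms(2,4) by blast
      then show ?thesis using True by simp
    next
      case False
      then have "h x = norm (x - c) powr (- m - 2) * (norm (x - c))\<^sup>2"
        using powr_add[of "norm (x - c)" "- m - 2" 2] by (simp add: h_def)
      then have "(x - c) \<bullet> h' x = - m * h x" by (simp add: h'_def power2_norm_eq_inner)
      then have "(x - c) \<bullet> g x = h x * ((x - c) \<bullet> grad \<phi> x) + \<phi> x * (- m * h x)"
        by (simp only: g_def inner_add_right inner_scaleR_right)
      then show ?thesis by (simp add: algebra_simps)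
    qed
  qed
  also have "integral\<^sup>L lborel \<dots> = (LINT x:S|lebesgue. (h x *\<^sub>R (x - c)) \<bullet> grad \<phi> x - (m - DIM('a)) * h x * \<phi> x)"
    using off grad_off
    by (intro continuous_compact_support_set_integral(2)[OF assms(3,4), symmetric] continuous_intros cont\<phi> conth) auto
  also have "\<dots> = (LINT x:S|lebesgue. (h x *\<^sub>R (x - c)) \<bullet> grad \<phi> x) - (LINT x:S|lebesgue. (m - DIM('a)) * h x * \<phi> x)"
    using off grad_off
    by (intro set_integral_diff continuous_compact_support_set_integral(1)[OF assms(3,4)] continuous_intros cont\<phi> conth) auto
  finally show ?thesis by (simp add: h_def)
qed

section \<open>The radial barrier\<close>

text \<open>
  For \<open>B, s > 0\<close> this radial function equals \<open>e\<close> on the unit sphere around \<open>c\<close> and increases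
  outwards. Its flux is a multiple of a power of the radius times the radial vector, so its
  \<open>p\<close>-Laplacian is explicit.
\<close>

definition radial_barrier :: "'a::euclidean_space \<Rightarrow> real \<Rightarrow> real \<Rightarrow> real \<Rightarrow> 'a \<Rightarrow> real" where
  "radial_barrier c e B s x = e + B * (1 - norm (x - c) powr (- s))"

lemma GDERIV_radial_barrier:
  assumes "x \<noteq> c"
  shows "GDERIV (radial_barrier c e B s) x :> (B * s * norm (x - c) powr (- s - 2)) *\<^sub>R (x - c)"
proof -
  have "DERIV (\<lambda>r. e + B * (1 - r)) (norm (x - c) powr (- s)) :> - B"
    by (auto intro!: derivative_eq_intros)
  from GDERIV_DERIV_compose[OF GDERIV_norm_powr[OF assms] this] show ?thesis
    by (simp add: radial_barrier_def[abs_def] mult.assoc)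
qed

lemma C1_on_radial_barrier:
  assumes "c \<notin> S"
  shows "C1_on S (radial_barrier c e B s)"
proof -
  have ne: "x \<noteq> c" if "x \<in> S" for x using that assms by auto
  have "continuous_on S (\<lambda>x. (B * s * norm (x - c) powr (- s - 2)) *\<^sub>R (x - c))"
    using ne by (intro continuous_intros) auto
  then have "continuous_on S (grad (radial_barrier c e B s))"
    by (rule continuous_on_eq) (simp add: grad_eqI[OF GDERIV_radial_barrier[OF ne]])
  moreover have "radial_barrier c e B s differentiable (at x)" if "x \<in> S" for x
    using GDERIV_radial_barrier[OF ne[OF that]] unfolding gderiv_def differentiable_def by blast
  ultimately show ?thesis by (simp add: C1_on_def)
qed

lemma p_flux_radial_barrier:
  assumes "x \<noteq> c" "B > 0" "s > 0"
  shows "p_flux p (radial_barrier c e B s) x =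
    (B * s) powr (p - 1) *\<^sub>R (norm (x - c) powr (- (1 + (s + 1) * (p - 1))) *\<^sub>R (x - c))"
proof -
  define r where "r = norm (x - c)"
  have r: "r > 0" using assms by (simp add: r_def)
  have "r powr (- s - 2) * r = r powr (- s - 1)"
  proof -
    have "- s - 1 = (- s - 2) + 1" by simp
    then show ?thesis using r by (simp only: powr_add powr_one less_imp_le)
  qed
  then have "norm (grad (radial_barrier c e B s) x) = B * s * r powr (- s - 1)"
    using assms by (simp add: grad_eqI[OF GDERIV_radial_barrier[OF assms(1)]] abs_mult flip: r_def)
  then have "norm (grad (radial_barrier c e B s) x) powr (p - 2) * (B * s * r powr (- s - 2)) =
      ((B * s) powr (p - 2) * (B * s)) * (r powr ((- s - 1) * (p - 2)) * r powr (- s - 2))"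
    using assms by (simp add: powr_mult powr_powr)
  also have "(B * s) powr (p - 2) * (B * s) = (B * s) powr (p - 1)"
    using assms powr_add[of "B * s" "p - 2" 1] by simp
  also have "r powr ((- s - 1) * (p - 2)) * r powr (- s - 2) = r powr (- (1 + (s + 1) * (p - 1)))"
    by (simp add: algebra_simps flip: powr_add)
  finally show ?thesis
    unfolding p_flux_def grad_eqI[OF GDERIV_radial_barrier[OF assms(1)]] by (simp flip: r_def)
qed

text \<open>
  With \<open>N\<close> the dimension, this choice of \<open>s\<close> makes the exponent \<open>1 + (s + 1) (p - 1)\<close> of the flux
  equal to \<open>N + p\<close>. As this exceeds \<open>N\<close>, the barrier satisfies \<open>- \<Delta>\<^sub>p w = q\<close> with an explicit \<open>q > 0\<close>,
  which a large \<open>B\<close> makes as large as desired on bounded subsets of \<open>S\<close>.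
\<close>

lemma weak_equation_radial_barrier:
  fixes c :: "'a::euclidean_space" and p :: real
  assumes "open S" "c \<notin> S" "compact K" "K \<subseteq> S" "C1_on S \<phi>" "\<And>x. x \<notin> K \<Longrightarrow> \<phi> x = 0"
    and "p > 1" "B > 0" and s: "s = DIM('a) / (p - 1)"
  shows "(LINT x:S|lebesgue. p_flux p (radial_barrier c e B s) x \<bullet> grad \<phi> x) =
    (LINT x:S|lebesgue. p * (B * s) powr (p - 1) * norm (x - c) powr (- (DIM('a) + p)) * \<phi> x)"
proof -
  have "s > 0" using s \<open>p > 1\<close> by simp
  have m: "1 + (s + 1) * (p - 1) = DIM('a) + p"
    using \<open>p > 1\<close> by (simp add: s field_simps)
  have flux: "p_flux p (radial_barrier c e B s) x =
      (B * s) powr (p - 1) *\<^sub>R (norm (x - c) powr (- (DIM('a) + p)) *\<^sub>R (x - c))" if "x \<in> S" for x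
  proof -
    have "x \<noteq> c" using that assms(2) by auto
    from p_flux_radial_barrier[OF this \<open>B > 0\<close> \<open>s > 0\<close>, of p e] show ?thesis unfolding m .
  qed
  have "(LINT x:S|lebesgue. p_flux p (radial_barrier c e B s) x \<bullet> grad \<phi> x) =
      (LINT x:S|lebesgue. (B * s) powr (p - 1) * ((norm (x - c) powr (- (DIM('a) + p)) *\<^sub>R (x - c)) \<bullet> grad \<phi> x))"
    unfolding set_lebesgue_integral_def
    by (intro Bochner_Integration.integral_cong refl) (auto simp: flux indicator_def)
  also have "\<dots> = (B * s) powr (p - 1) *
      (LINT x:S|lebesgue. ((DIM('a) + p) - DIM('a)) * norm (x - c) powr (- (DIM('a) + p)) * \<phi> x)"
    unfolding set_integral_mult_right
    by (subst weak_divergence_radial_field[OF assms(1-6)]) auto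
  also have "\<dots> = (LINT x:S|lebesgue. p * (B * s) powr (p - 1) * norm (x - c) powr (- (DIM('a) + p)) * \<phi> x)"
    unfolding set_integral_mult_right[symmetric] by (simp add: mult_ac)
  finally show ?thesis .
qed

section \<open>Decay at the boundary\<close>

text \<open>
  The barrier is centred at distance 1 below the boundary point \<open>z\<close>, and the comparison takes place in
  the part of the half space within distance \<open>1 + l / 2\<close> of the centre, which lies in the strip. On
  the flat part of its boundary \<open>u = 0 < e \<le> w\<close>, and on the spherical part \<open>u \<le> M < w\<close>. Wherever
  \<open>u > w\<close>, also \<open>u > e\<close>, so that monotonicity of \<open>f\<close> bounds the right-hand side by the constant
  \<open>f e\<close>, however singular \<open>f\<close> is at 0.
\<close>

lemma boundary_estimate:
  fixes k :: "'n::finite" and u :: "real ^ 'n \<Rightarrow> real" and p :: real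
  assumes "p > 1" and contf: "continuous_on {0<..} f"
    and anti: "strict_antimono_on {0<..<\<rho>} f"
    and C1: "C1_on (half_space k) u"
    and cont: "continuous_on (closure (half_space k)) u"
    and sol: "weak_p_laplace_solution p f (half_space k) u"
    and pos: "\<forall>x\<in>half_space k. u x > 0"
    and bdry: "\<forall>x\<in>frontier (half_space k). u x = 0"
    and "l > 0" and M: "M < \<rho>" "\<And>x. x \<in> strip k l \<Longrightarrow> u x \<le> M"
    and e: "0 < e" "e < \<rho>" and "B > 0" and s: "s = CARD('n) / (p - 1)"
    and B_flux: "f e < p * (B * s) powr (p - 1) * (1 + l / 2) powr (- (CARD('n) + p))"
    and B_outer: "M < e + B * (1 - (1 + l / 2) powr (- s))"
    and z: "z $ k = 0" and t: "0 < t" "t < l / 2"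
  shows "u (z + t *\<^sub>R axis k 1) \<le> e + B * (1 - (1 + t) powr (- s))"
proof -
  define c where "c = z - axis k 1"
  define R where "R = 1 + l / 2"
  define w where "w = radial_barrier c e B s"
  define q where "q x = p * (B * s) powr (p - 1) * norm (x - c) powr (- (CARD('n) + p))" for x
  define D where "D = half_space k \<inter> ball c R"
  have "s > 0" using s \<open>p > 1\<close> by simp
  have ck: "(x - c) $ k = x $ k + 1" for x using z by (simp add: c_def)
  have norm_c: "x $ k + 1 \<le> norm (x - c)" for x
    using component_le_norm_cart[of "x - c" k] ck[of x] by linarith
  have c: "c \<notin> half_space k" using ck[of c] by (simp add: half_space_def)
  have w_ge: "e \<le> w x" if "0 \<le> x $ k" for x
  proof -
    have "1 \<le> norm (x - c)" using norm_c[of x] that by linarith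
    then have "norm (x - c) powr (- s) \<le> 1"
      using powr_mono2'[of "- s" 1 "norm (x - c)"] \<open>s > 0\<close> by simp
    then show ?thesis using \<open>B > 0\<close> by (simp add: w_def radial_barrier_def)
  qed
  have in_strip: "x \<in> strip k l" if "0 < x $ k" "norm (x - c) \<le> R" for x
    using that norm_c[of x] \<open>l > 0\<close> by (auto simp: strip_def R_def)
  have "z + t *\<^sub>R axis k 1 - c = (1 + t) *\<^sub>R axis k 1"
    by (simp add: c_def algebra_simps)
  then have norm_t: "norm (z + t *\<^sub>R axis k 1 - c) = 1 + t"
    using t by (simp add: norm_axis_1)
  have "u (z + t *\<^sub>R axis k 1) \<le> w (z + t *\<^sub>R axis k 1)"
  proof (rule weak_comparison[where S = "half_space k" and q = q and D = D, OF \<open>p > 1\<close> open_half_space C1])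
    show "C1_on (half_space k) w" unfolding w_def using c by (rule C1_on_radial_barrier)
    have "continuous_on (half_space k) u" using C1 by (rule C1_on_imp_continuous_on)
    then show "continuous_on (half_space k) (\<lambda>x. f (u x))"
      using pos by (intro continuous_on_compose2[OF contf]) auto
    show "continuous_on (half_space k) q"
      unfolding q_def using c by (intro continuous_intros) auto
    show "weak_p_laplace_solution p f (half_space k) u" by fact
    show "(LINT x:half_space k|lebesgue. p_flux p w x \<bullet> grad \<phi> x) = (LINT x:half_space k|lebesgue. q x * \<phi> x)"
      if "compact K" "K \<subseteq> half_space k" "C1_on (half_space k) \<phi>" "\<And>x. x \<notin> K \<Longrightarrow> \<phi> x = 0" for \<phi> K
      using weak_equation_radial_barrier[OF open_half_space c that \<open>p > 1\<close> \<open>B > 0\<close>, of s e] s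
      by (simp add: w_def q_def)
    show "open D" "D \<subseteq> half_space k" by (auto simp: D_def open_half_space)
    show "compact {x\<in>D. w x \<le> u x}"
    proof -
      \<comment> \<open>Closing the region up adds no contact points, since \<open>u < w\<close> on its boundary.\<close>
      define E where "E = closure (half_space k) \<inter> cball c R"
      have E: "closed E" "bounded E" by (auto simp: E_def bounded_Int)
      have "c \<notin> E" using ck[of c] by (simp add: E_def closure_half_space)
      then have "continuous_on E w"
        unfolding w_def by (intro C1_on_imp_continuous_on C1_on_radial_barrier)
      moreover have "continuous_on E u" using cont by (rule continuous_on_subset) (simp add: E_def)
      ultimately have "closed {x\<in>E. w x \<le> u x}" using E(1) by (rule continuous_on_closed_Collect_le)
      moreover have "bounded {x\<in>E. w x \<le> u x}" using E(2) by (rule bounded_subset) auto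
      moreover have "x \<in> D" if "x \<in> E" "w x \<le> u x" for x
      proof -
        have x: "0 \<le> x $ k" "norm (x - c) \<le> R"
          using that by (auto simp: E_def closure_half_space dist_norm norm_minus_commute)
        have "x $ k \<noteq> 0"
        proof
          assume "x $ k = 0"
          then have "u x = 0" using bdry by (simp add: frontier_half_space)
          with w_ge[OF x(1)] that e show False by simp
        qed
        with x have xk: "0 < x $ k" by simp
        have "norm (x - c) \<noteq> R"
        proof
          assume "norm (x - c) = R"
          then have "M < w x" using B_outer by (simp add: w_def radial_barrier_def R_def)
          with M(2)[OF in_strip[OF xk x(2)]] that show False by simp
        qed
        with x xk show ?thesis
          by (simp add: D_def half_space_def dist_norm norm_minus_commute)
      qed
      then have "{x\<in>D. w x \<le> u x} = {x\<in>E. w x \<le> u x}"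
        using closure_subset[of "half_space k"] by (auto simp: D_def E_def)
      ultimately show ?thesis by (simp add: compact_eq_bounded_closed)
    qed
    show "f (u x) < q x" if "x \<in> D" "w x < u x" for x
    proof -
      have x: "0 < x $ k" "norm (x - c) < R"
        using that by (auto simp: D_def half_space_def dist_norm norm_minus_commute)
      have "e < u x" using w_ge[of x] x that by simp
      moreover have "u x < \<rho>" using M(2)[OF in_strip[of x]] M(1) x by simp
      ultimately have "f (u x) < f e"
        using anti e by (auto simp: monotone_on_def)
      also have "\<dots> < p * (B * s) powr (p - 1) * R powr (- (CARD('n) + p))"
        using B_flux by (simp add: R_def)
      also have "\<dots> \<le> q x"
      proof -
        have "R powr (- (CARD('n) + p)) \<le> norm (x - c) powr (- (CARD('n) + p))"
          using x norm_c[of x] \<open>p > 1\<close> by (intro powr_mono2') auto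
        then show ?thesis using \<open>p > 1\<close> unfolding q_def by (intro mult_left_mono) auto
      qed
      finally show ?thesis .
    qed
    show "z + t *\<^sub>R axis k 1 \<in> D"
      using t z norm_t by (simp add: D_def half_space_def R_def dist_norm norm_minus_commute)
  qed
  also have "w (z + t *\<^sub>R axis k 1) = e + B * (1 - (1 + t) powr (- s))"
    by (simp add: w_def radial_barrier_def norm_t)
  finally show ?thesis .
qed

text \<open>
  Given \<open>\<epsilon>\<close>, take \<open>e\<close> below \<open>\<epsilon>\<close> and \<open>\<rho>\<close>. The bound of the previous lemma does not involve the
  boundary point, and it tends to \<open>e\<close> as \<open>t\<close> tends to 0.
\<close>

theorem proposition1:
  fixes k :: "'n::finite"
    and u :: "real ^ 'n \<Rightarrow> real"
    and f :: "real \<Rightarrow> real"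
    and p \<alpha> \<rho> l :: real
  assumes "p > 1"
    and "locally_lipschitz_on {0<..} f"
    and "\<rho> > 0"
    and "strict_antimono_on {0<..<\<rho>} f"
    and "0 < \<alpha>" and "\<alpha> < 1"
    and "C1_holder_loc \<alpha> (half_space k) u"
    and "continuous_on (closure (half_space k)) u"
    and "weak_p_laplace_solution p f (half_space k) u"
    and "\<forall>x\<in>half_space k. u x > 0"
    and "\<forall>x\<in>frontier (half_space k). u x = 0"
    and "l > 0"
    and "Linf_norm (strip k l) u < ereal \<rho>"
  shows "uniform_limit {x. x $ k = 0} (\<lambda>t x. u (x + t *\<^sub>R axis k 1)) (\<lambda>_. 0) (at_right 0)"
proof (rule uniform_limitI)
  fix \<epsilon> :: real
  assume "\<epsilon> > 0"
  have C1: "C1_on (half_space k) u" using assms(7) by (simp add: C1_holder_loc_def)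
  have contf: "continuous_on {0<..} f"
    using assms(2) unfolding locally_lipschitz_on_def
    by (rule local_lipschitz_continuous_on) simp
  have open_strip: "open (strip k l)"
    unfolding strip_def
    by (intro open_Collect_conj open_Collect_less continuous_intros)
  obtain M where M: "M < \<rho>" "\<And>x. x \<in> strip k l \<Longrightarrow> u x \<le> M"
  proof (rule Linf_norm_less_imp_bound[OF open_strip _ assms(13)])
    show "continuous_on (strip k l) u"
      using C1_on_imp_continuous_on[OF C1]
      by (rule continuous_on_subset) (auto simp: strip_def half_space_def)
  qed auto
  define e where "e = min (\<epsilon> / 2) (\<rho> / 2)"
  have e: "0 < e" "e < \<rho>" "e < \<epsilon>" using \<open>\<epsilon> > 0\<close> \<open>\<rho> > 0\<close> by (auto simp: e_def)
  define s where "s = CARD('n) / (p - 1)"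
  have "s > 0" using \<open>p > 1\<close> by (simp add: s_def)
  define a where "a = (1 + l / 2) powr (- (CARD('n) + p))"
  define b where "b = 1 - (1 + l / 2) powr (- s)"
  have ab: "a > 0" "b > 0"
    using \<open>l > 0\<close> \<open>s > 0\<close> powr_less_mono2_neg[of "- s" 1 "1 + l / 2"] by (auto simp: a_def b_def)
  have "filterlim (\<lambda>B. p * (B * s) powr (p - 1) * a) at_top at_top"
    using \<open>p > 1\<close> \<open>s > 0\<close> ab by real_asymp
  moreover have "filterlim (\<lambda>B. e + B * b) at_top at_top"
    using ab by real_asymp
  ultimately have "\<forall>\<^sub>F B in at_top. f e < p * (B * s) powr (p - 1) * a \<and> M < e + B * b \<and> 0 < B"
    by (simp add: filterlim_at_top_dense eventually_conj_iff eventually_gt_at_top)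
  then obtain B where B: "f e < p * (B * s) powr (p - 1) * a" "M < e + B * b" "0 < B"
    by (auto simp: eventually_at_top_linorder)
  have "((\<lambda>t. e + B * (1 - (1 + t) powr (- s))) \<longlongrightarrow> e + B * (1 - (1 + 0) powr (- s))) (at_right 0)"
    by (intro tendsto_intros) auto
  then have "\<forall>\<^sub>F t in at_right 0. e + B * (1 - (1 + t) powr (- s)) < \<epsilon>"
    using e by (intro order_tendstoD(2)) auto
  moreover have "\<forall>\<^sub>F t in at_right 0. 0 < t \<and> t < l / 2"
    using eventually_at_right_real[of 0 "l / 2"] \<open>l > 0\<close> by simp
  ultimately show "\<forall>\<^sub>F t in at_right 0. \<forall>x\<in>{x. x $ k = 0}. dist (u (x + t *\<^sub>R axis k 1)) 0 < \<epsilon>"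
  proof eventually_elim
    case (elim t)
    show ?case
    proof
      fix x :: "real ^ 'n"
      assume "x \<in> {x. x $ k = 0}"
      then have x: "x $ k = 0" by simp
      have "u (x + t *\<^sub>R axis k 1) \<le> e + B * (1 - (1 + t) powr (- s))"
        using B e M elim x assms \<open>s > 0\<close> contf C1
        by (intro boundary_estimate[where k = k and f = f and \<rho> = \<rho> and M = M and l = l and p = p])
          (auto simp: s_def a_def b_def)
      moreover have "0 < u (x + t *\<^sub>R axis k 1)"
        using assms(10) x elim by (simp add: half_space_def)
      ultimately show "dist (u (x + t *\<^sub>R axis k 1)) 0 < \<epsilon>" using elim by simp
    qed
  qed
qed

end
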